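(* Suppose that $u_n$, $n=1,2,\ldots$, are fuzzy sets in $F_{USCGCON}(\mathbb{R}^m)$, and that $u\neq\widehat{\emptyset}$ is a fuzzy set in $F_{USCG}(\mathbb{R}^m)$. Then $u_n$ $\Gamma$-converges to $u$ if and only if $H_{\rm end}(u_n,u)\to0$ as $n\to\infty$.
   Context: A fuzzy set on $\mathbb{R}^m$ is a function $u:\mathbb{R}^m\to[0,1]$; $\widehat{\emptyset}$ denotes the identically zero fuzzy set. For $\alpha\in(0,1]$, $[u]_\alpha=\{x:u(x)\ge\alpha\}$. $F_{USCG}(\mathbb{R}^m)$ is the set of all upper semi-continuous fuzzy sets $u$ on $\mathbb{R}^m$ with $[u]_\alpha$ bounded for each $\alpha\in(0,1]$ (cuts may be empty). $F_{USCGCON}(\mathbb{R}^m)$ is the set of all $u\in F_{USCG}(\mathbb{R}^m)$ such that $[u]_\alpha$ is connected for each $\alpha\in(0,1]$ (the empty set counts as connected). The endograph of $u$ is ${\rm end}\,u=\{(x,t)\in\mathbb{R}^m\times[0,1]:u(x)\ge t\}$, and the endograph metric is $H_{\rm end}(u,v)=H({\rm end}\,u,{\rm end}\,v)$, where $H(A,B)=\max\{\sup_{a\in A}\inf_{b\in B}d(a,b),\ \sup_{b\in B}\inf_{a\in A}d(a,b)\}$ is the Hausdorff metric on nonempty closed sets ($d$ Euclidean). For sets $C_n$ in a metric space, $\liminf_n C_n$ is the set of limits $x=\lim_n x_n$ with $x_n\in C_n$, and $\limsup_n C_n$ is the set of limits $x=\lim_j x_{n_j}$ with $x_{n_j}\in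 C_{n_j}$ along some subsequence. $\{C_n\}$ Kuratowski converges to $C$ if $C=\liminf_n C_n=\limsup_n C_n$. $u_n$ $\Gamma$-converges to $u$ if ${\rm end}\,u_n$ Kuratowski converges to ${\rm end}\,u$. *)

theory Defs
  imports "HOL-Analysis.Analysis"
begin

definition fuzzy_set :: "('a \<Rightarrow> real) \<Rightarrow> bool" where
  "fuzzy_set u \<longleftrightarrow> (\<forall>x. 0 \<le> u x \<and> u x \<le> 1)"

definition empty_fuzzy_set :: "'a \<Rightarrow> real" where
  "empty_fuzzy_set = (\<lambda>x. 0)"

definition cut :: "('a \<Rightarrow> real) \<Rightarrow> real \<Rightarrow> 'a set" where
  "cut u \<alpha> = {x. \<alpha> \<le> u x}"

definition upper_semicontinuous :: "('a::topological_space \<Rightarrow> real) \<Rightarrow> bool" where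
  "upper_semicontinuous u \<longleftrightarrow> (\<forall>x c. u x < c \<longrightarrow> (\<forall>\<^sub>F y in nhds x. u y < c))"

(* Cuts may be empty; the library's bounded and connected both hold of the empty set. *)

definition F_USCG :: "('a::metric_space \<Rightarrow> real) set" where
  "F_USCG = {u. fuzzy_set u \<and> upper_semicontinuous u \<and> (\<forall>\<alpha>\<in>{0<..1}. bounded (cut u \<alpha>))}"

definition F_USCGCON :: "('a::metric_space \<Rightarrow> real) set" where
  "F_USCGCON = {u \<in> F_USCG. \<forall>\<alpha>\<in>{0<..1}. connected (cut u \<alpha>)}"

(* The endograph is a subset of the closed subspace with second coordinate in [0,1], but is
   typed in the full product, which carries the Euclidean product metric. As that subspace is
   closed, the Kuratowski limits below are the same in the subspace and in the product. *)

definition endograph :: "('a \<Rightarrow> real) \<Rightarrow> ('a \<times> real) set" where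
  "endograph u = {(x, t). t \<in> {0..1} \<and> t \<le> u x}"

(* Valued in ennreal because the suprema can be infinite for general closed sets. *)

definition hausdorff_metric :: "'a::metric_space set \<Rightarrow> 'a set \<Rightarrow> ennreal" where
  "hausdorff_metric A B =
     max (SUP a\<in>A. INF b\<in>B. ennreal (dist a b)) (SUP b\<in>B. INF a\<in>A. ennreal (dist a b))"

definition H_end :: "('a::metric_space \<Rightarrow> real) \<Rightarrow> ('a \<Rightarrow> real) \<Rightarrow> ennreal" where
  "H_end u v = hausdorff_metric (endograph u) (endograph v)"

definition kuratowski_liminf :: "(nat \<Rightarrow> 'a::metric_space set) \<Rightarrow> 'a set" where
  "kuratowski_liminf C = {x. \<exists>f. (\<forall>n. f n \<in> C n) \<and> f \<longlonglongrightarrow> x}"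

definition kuratowski_limsup :: "(nat \<Rightarrow> 'a::metric_space set) \<Rightarrow> 'a set" where
  "kuratowski_limsup C =
     {x. \<exists>r f. strict_mono r \<and> (\<forall>j. f j \<in> C (r j)) \<and> f \<longlonglongrightarrow> x}"

definition kuratowski_converges :: "(nat \<Rightarrow> 'a::metric_space set) \<Rightarrow> 'a set \<Rightarrow> bool" where
  "kuratowski_converges C L \<longleftrightarrow> L = kuratowski_liminf C \<and> L = kuratowski_limsup C"

definition Gamma_converges :: "(nat \<Rightarrow> 'a::metric_space \<Rightarrow> real) \<Rightarrow> ('a \<Rightarrow> real) \<Rightarrow> bool" where
  "Gamma_converges u v \<longleftrightarrow> kuratowski_converges (\<lambda>n. endograph (u n)) (endograph v)"

end

theory Submission
  imports Defs
begin

text \<open>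
  Kuratowski convergence of closed sets is weaker than Hausdorff convergence only because mass may
  escape to infinity. On a compact set it is automatically uniform: finitely many points of the
  limit approximate a compact part of it (\<open>compact_near_kuratowski_liminf\<close>), and the sets
  eventually leave every compact set that misses the upper limit
  (\<open>compact_avoids_kuratowski_limsup\<close>). An endograph has two parts. The part of height less than
  \<open>e\<close> lies within \<open>e\<close> of the base, and the base belongs to every endograph, so this part may be
  ignored. The part of \<open>end u\<close> of height at least \<open>e\<close> is compact, because the cuts of \<open>u\<close> are
  bounded. Hence the half of the Hausdorff distance that measures how far \<open>end u\<close> lies from the
  other endograph tends to zero.

  For the other half the high parts of the endographs of the approximating fuzzy sets must stay in a
  common bounded set. As \<open>u\<close> is not identically zero, some point of \<open>end u\<close> has positive height
  over a base point \<open>x\<^sub>0\<close>, so every low cut of \<open>us n\<close> eventually has a point close to \<open>x\<^sub>0\<close>. Take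
  a sphere around \<open>x\<^sub>0\<close> that surrounds the corresponding cut of \<open>u\<close>. This sphere, lifted to the height
  of the cut, is compact and misses \<open>end u\<close>, so eventually the cut of \<open>us n\<close> does not meet
  the sphere. Being connected, that cut is then trapped inside (\<open>eventually_cut_in_ball\<close>).
  Thus no mass escapes, and compactness applies again.
\<close>

section \<open>The Hausdorff metric in terms of neighbourhoods\<close>

lemma near_if_hausdorff_metric_less:
  assumes "hausdorff_metric A B < ennreal e"
  shows "(\<forall>a\<in>A. \<exists>b\<in>B. dist a b < e) \<and> (\<forall>b\<in>B. \<exists>a\<in>A. dist a b < e)"
proof (intro conjI ballI)
  fix a assume "a \<in> A"
  then have "(INF b\<in>B. ennreal (dist a b)) \<le> hausdorff_metric A B"
    unfolding hausdorff_metric_def by (intro max.coboundedI1 SUP_upper)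
  then have "(INF b\<in>B. ennreal (dist a b)) < ennreal e"
    using assms by (rule le_less_trans)
  then show "\<exists>b\<in>B. dist a b < e"
    by (auto simp: INF_less_iff ennreal_less_iff)
next
  fix b assume "b \<in> B"
  then have "(INF a\<in>A. ennreal (dist a b)) \<le> hausdorff_metric A B"
    unfolding hausdorff_metric_def by (intro max.coboundedI2 SUP_upper)
  then have "(INF a\<in>A. ennreal (dist a b)) < ennreal e"
    using assms by (rule le_less_trans)
  then show "\<exists>a\<in>A. dist a b < e"
    by (auto simp: INF_less_iff ennreal_less_iff)
qed

lemma hausdorff_metric_le_if_near:
  assumes "\<forall>a\<in>A. \<exists>b\<in>B. dist a b < e" and "\<forall>b\<in>B. \<exists>a\<in>A. dist a b < e"
  shows "hausdorff_metric A B \<le> ennreal e"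
  unfolding hausdorff_metric_def
proof (intro max.boundedI SUP_least)
  fix a assume "a \<in> A"
  then obtain b where "b \<in> B" "dist a b < e" using assms(1) by blast
  then show "(INF b\<in>B. ennreal (dist a b)) \<le> ennreal e"
    by (intro INF_lower2[of b]) (auto intro: ennreal_leI)
next
  fix b assume "b \<in> B"
  then obtain a where "a \<in> A" "dist a b < e" using assms(2) by blast
  then show "(INF a\<in>A. ennreal (dist a b)) \<le> ennreal e"
    by (intro INF_lower2[of a]) (auto intro: ennreal_leI)
qed

lemma tendsto_hausdorff_metric_zero_iff:
  "(\<lambda>n. hausdorff_metric (C n) L) \<longlonglongrightarrow> 0 \<longleftrightarrow>
    (\<forall>e>0. \<forall>\<^sub>F n in sequentially.
      (\<forall>a\<in>C n. \<exists>b\<in>L. dist a b < e) \<and> (\<forall>b\<in>L. \<exists>a\<in>C n. dist a b < e))"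
  (is "?lhs \<longleftrightarrow> (\<forall>e>0. ?near e)")
proof
  assume lim: ?lhs
  show "\<forall>e>0. ?near e"
  proof (intro allI impI)
    fix e :: real assume "e > 0"
    then have "\<forall>\<^sub>F n in sequentially. hausdorff_metric (C n) L < ennreal e"
      using lim by (intro order_tendstoD) auto
    then show "?near e"
      by (rule eventually_mono) (rule near_if_hausdorff_metric_less)
  qed
next
  assume near: "\<forall>e>0. ?near e"
  show ?lhs
  proof (rule order_tendstoI)
    fix y :: ennreal assume "0 < y"
    \<comment> \<open>\<open>y\<close> may be infinite, so a finite bound is interposed.\<close>
    then obtain z where z: "0 < z" "z < y" using dense by blast
    define e where "e = enn2real z"
    have "z \<noteq> top" using z(2) by auto
    then have e: "e > 0" "ennreal e = z"
      using z(1) by (auto simp: e_def enn2real_positive_iff less_top)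
    have "?near e" using near e(1) by blast
    then show "\<forall>\<^sub>F n in sequentially. hausdorff_metric (C n) L < y"
    proof (rule eventually_mono)
      fix n
      assume "(\<forall>a\<in>C n. \<exists>b\<in>L. dist a b < e) \<and> (\<forall>b\<in>L. \<exists>a\<in>C n. dist a b < e)"
      then have "hausdorff_metric (C n) L \<le> ennreal e"
        by (intro hausdorff_metric_le_if_near) auto
      then show "hausdorff_metric (C n) L < y" using e(2) z(2) by auto
    qed
  qed auto
qed

section \<open>Kuratowski limits\<close>

lemma kuratowski_liminf_near:
  assumes "x \<in> kuratowski_liminf C" and "e > 0"
  shows "\<forall>\<^sub>F n in sequentially. \<exists>c\<in>C n. dist x c < e"
proof -
  obtain f where f: "\<And>n. f n \<in> C n" "f \<longlonglongrightarrow> x"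
    using assms(1) by (auto simp: kuratowski_liminf_def)
  have "\<forall>\<^sub>F n in sequentially. dist (f n) x < e"
    using f(2) assms(2) by (rule tendstoD)
  then show ?thesis
    by (rule eventually_mono) (use f(1) in \<open>auto simp: dist_commute\<close>)
qed

text \<open>
  A single sequence has to serve every tolerance, so the points chosen are nearly closest to \<open>x\<close>.
  Nonemptiness is essential, as the sequence must pass through every \<open>C n\<close>.
\<close>

lemma kuratowski_liminfI:
  assumes ne: "\<And>n. C n \<noteq> {}"
    and near: "\<And>e. e > 0 \<Longrightarrow> \<forall>\<^sub>F n in sequentially. \<exists>c\<in>C n. dist x c < e"
  shows "x \<in> kuratowski_liminf C"
proof -
  have "\<exists>c\<in>C n. dist x c < infdist x (C n) + 1 / real (Suc n)" for n
  proof -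
    have "Inf (dist x ` C n) < infdist x (C n) + 1 / real (Suc n)"
      using ne[of n] by (simp add: infdist_notempty)
    then show ?thesis
      using cInf_lessD[of "dist x ` C n"] ne[of n] by auto
  qed
  then obtain f where f: "\<And>n. f n \<in> C n"
    "\<And>n. dist x (f n) < infdist x (C n) + 1 / real (Suc n)"
    by metis
  have "f \<longlonglongrightarrow> x"
  proof (rule tendstoI)
    fix e :: real assume "e > 0"
    then have "\<forall>\<^sub>F n in sequentially. \<exists>c\<in>C n. dist x c < e / 2"
      by (intro near) simp
    moreover have "\<forall>\<^sub>F n in sequentially. 1 / real (Suc n) < e / 2"
      using LIMSEQ_Suc[OF lim_1_over_n] \<open>e > 0\<close> by (intro order_tendstoD) auto
    ultimately show "\<forall>\<^sub>F n in sequentially. dist (f n) x < e"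
    proof eventually_elim
      case (elim n)
      then obtain c where "c \<in> C n" "dist x c < e / 2" by blast
      then have "infdist x (C n) < e / 2"
        using infdist_le[of c "C n" x] by linarith
      then show ?case using f(2)[of n] elim(2) by (simp add: dist_commute)
    qed
  qed
  then show ?thesis using f(1) by (auto simp: kuratowski_liminf_def)
qed

lemma kuratowski_liminf_subset_limsup: "kuratowski_liminf C \<subseteq> kuratowski_limsup C"
  unfolding kuratowski_liminf_def kuratowski_limsup_def
  using strict_mono_id by fastforce

lemma hausdorff_imp_kuratowski_converges:
  assumes lim: "(\<lambda>n. hausdorff_metric (C n) L) \<longlonglongrightarrow> 0"
    and ne: "\<And>n. C n \<noteq> {}" and L: "closed L" "L \<noteq> {}"
  shows "kuratowski_converges C L"
proof -
  have near: "\<forall>\<^sub>F n in sequentially.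
      (\<forall>a\<in>C n. \<exists>b\<in>L. dist a b < e) \<and> (\<forall>b\<in>L. \<exists>a\<in>C n. dist a b < e)" if "e > 0" for e
    using lim that by (simp add: tendsto_hausdorff_metric_zero_iff)
  have "L \<subseteq> kuratowski_liminf C"
  proof
    fix x assume "x \<in> L"
    show "x \<in> kuratowski_liminf C"
    proof (rule kuratowski_liminfI[OF ne])
      fix e :: real assume "e > 0"
      show "\<forall>\<^sub>F n in sequentially. \<exists>c\<in>C n. dist x c < e"
        using near[OF \<open>e > 0\<close>]
        by (rule eventually_mono) (use \<open>x \<in> L\<close> dist_commute in metis)
    qed
  qed
  moreover have "kuratowski_limsup C \<subseteq> L"
  proof
    fix x assume "x \<in> kuratowski_limsup C"
    then obtain r f where r: "strict_mono r" and f: "\<And>j. f j \<in> C (r j)" "f \<longlonglongrightarrow> x"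
      by (auto simp: kuratowski_limsup_def)
    have "\<exists>b\<in>L. dist b x < e" if "e > 0" for e
    proof -
      have "\<forall>\<^sub>F j in sequentially. \<forall>a\<in>C (r j). \<exists>b\<in>L. dist a b < e / 2"
        using eventually_subseq[OF r near[of "e / 2"]] that by (simp add: eventually_conj_iff)
      moreover have "\<forall>\<^sub>F j in sequentially. dist (f j) x < e / 2"
        using f(2) that by (intro tendstoD) auto
      ultimately have "\<forall>\<^sub>F j in sequentially. \<exists>b\<in>L. dist b x < e"
      proof eventually_elim
        case (elim j)
        then obtain b where b: "b \<in> L" "dist (f j) b < e / 2" using f(1) by blast
        then have "dist b x < e"
          using elim(2) dist_triangle_half_r[of "f j" b e x] by blast
        then show ?case using b(1) by blast
      qed
      then show ?thesis by (auto simp: eventually_sequentially)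
    qed
    then have "x \<in> closure L" by (auto simp: closure_approachable)
    then show "x \<in> L" using L(1) by simp
  qed
  ultimately show ?thesis
    using kuratowski_liminf_subset_limsup[of C] by (auto simp: kuratowski_converges_def)
qed

text \<open>
  A finite \<open>e/2\<close>-net of \<open>K\<close> turns the pointwise approximation into a uniform one.
\<close>

lemma compact_near_kuratowski_liminf:
  assumes K: "compact K" "K \<subseteq> kuratowski_liminf C" and "e > 0"
  shows "\<forall>\<^sub>F n in sequentially. \<forall>x\<in>K. \<exists>c\<in>C n. dist c x < e"
proof -
  have "e / 2 > 0" using assms(3) by simp
  then obtain N where N: "finite N" "N \<subseteq> K" "K \<subseteq> (\<Union>y\<in>N. ball y (e / 2))"
    using compactE_image[OF K(1), of K "\<lambda>y. ball y (e / 2)"] by force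
  have "\<forall>\<^sub>F n in sequentially. \<forall>y\<in>N. \<exists>c\<in>C n. dist y c < e / 2"
    using N K(2) \<open>e / 2 > 0\<close> by (intro eventually_ball_finite ballI kuratowski_liminf_near) auto
  then show ?thesis
  proof (rule eventually_mono)
    fix n assume near: "\<forall>y\<in>N. \<exists>c\<in>C n. dist y c < e / 2"
    show "\<forall>x\<in>K. \<exists>c\<in>C n. dist c x < e"
    proof
      fix x assume "x \<in> K"
      then obtain y where y: "y \<in> N" "dist y x < e / 2" using N(3) by auto
      then obtain c where c: "c \<in> C n" "dist y c < e / 2" using near by blast
      then have "dist c x < e"
        using y(2) dist_triangle_half_r[of y c e x] by blast
      then show "\<exists>c\<in>C n. dist c x < e" using c(1) by blast
    qed
  qed
qed

text \<open>
  If the sets met \<open>K\<close> infinitely often, the common points would accumulate in \<open>K\<close> at a point of the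
  upper limit.
\<close>

lemma compact_avoids_kuratowski_limsup:
  assumes K: "compact K" "K \<inter> kuratowski_limsup C = {}"
  shows "\<forall>\<^sub>F n in sequentially. C n \<inter> K = {}"
proof (rule ccontr)
  assume "\<not> ?thesis"
  then obtain r :: "nat \<Rightarrow> nat" where r: "strict_mono r" "\<And>j. C (r j) \<inter> K \<noteq> {}"
    using not_eventually_sequentiallyD by blast
  then have "\<forall>j. \<exists>c. c \<in> C (r j) \<and> c \<in> K" by blast
  then obtain f where f: "\<And>j. f j \<in> C (r j)" "\<And>j. f j \<in> K" by metis
  obtain l s where l: "l \<in> K" and s: "strict_mono (s :: nat \<Rightarrow> nat)" "(f \<circ> s) \<longlonglongrightarrow> l"
    using K(1) f(2) unfolding compact_def by metis
  have "strict_mono (r \<circ> s)" using r(1) s(1) by (rule strict_mono_o)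
  moreover have "\<forall>j. (f \<circ> s) j \<in> C ((r \<circ> s) j)" using f(1) by simp
  ultimately have "l \<in> kuratowski_limsup C"
    using s(2) unfolding kuratowski_limsup_def by blast
  then show False using K(2) l by blast
qed

section \<open>Endographs\<close>

lemma base_in_endograph:
  assumes "fuzzy_set u"
  shows "(x, 0) \<in> endograph u"
  using assms by (auto simp: endograph_def fuzzy_set_def)

lemma closed_endograph:
  fixes u :: "'a::metric_space \<Rightarrow> real"
  assumes "upper_semicontinuous u"
  shows "closed (endograph u)"
  unfolding closed_sequential_limits
proof (intro allI impI, elim conjE)
  fix f :: "nat \<Rightarrow> 'a \<times> real" and p
  assume f: "\<forall>n. f n \<in> endograph u" "f \<longlonglongrightarrow> p"
  obtain x t where p: "p = (x, t)" by fastforce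
  have fst: "(\<lambda>n. fst (f n)) \<longlonglongrightarrow> x" and snd: "(\<lambda>n. snd (f n)) \<longlonglongrightarrow> t"
    using tendsto_fst[OF f(2)] tendsto_snd[OF f(2)] p by auto
  have inend: "0 \<le> snd (f n)" "snd (f n) \<le> 1" "snd (f n) \<le> u (fst (f n))" for n
    using f(1)[rule_format, of n] by (auto simp: endograph_def)
  have "0 \<le> t" "t \<le> 1"
    using LIMSEQ_le_const[OF snd] LIMSEQ_le_const2[OF snd] inend by blast+
  moreover have "t \<le> u x"
  proof (rule ccontr)
    assume "\<not> t \<le> u x"
    then obtain c where c: "u x < c" "c < t" using dense[of "u x" t] by auto
    have "\<forall>\<^sub>F n in sequentially. u (fst (f n)) < c"
      using assms c(1) fst unfolding upper_semicontinuous_def by (auto simp: filterlim_iff)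
    moreover have "\<forall>\<^sub>F n in sequentially. c < snd (f n)"
      using snd c(2) by (rule order_tendstoD)
    ultimately have "\<forall>\<^sub>F n in sequentially. False"
      by eventually_elim (metis inend(3) less_le_trans not_less_iff_gr_or_eq order_less_trans)
    then show False by simp
  qed
  ultimately show "p \<in> endograph u" by (auto simp: p endograph_def)
qed

lemma compact_high_part_of_endograph:
  fixes u :: "'a::heine_borel \<Rightarrow> real"
  assumes u: "u \<in> F_USCG" and "0 < e" "e \<le> 1"
  shows "compact (endograph u \<inter> (UNIV \<times> {e..1}))"
proof (unfold compact_eq_bounded_closed, intro conjI)
  have "bounded (cut u e \<times> {e..1})"
    using assms by (intro bounded_Times) (auto simp: F_USCG_def)
  then show "bounded (endograph u \<inter> (UNIV \<times> {e..1}))"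
    by (rule bounded_subset) (auto simp: endograph_def cut_def)
  show "closed (endograph u \<inter> (UNIV \<times> {e..1}))"
    using u by (intro closed_Int closed_Times closed_endograph) (auto simp: F_USCG_def)
qed

section \<open>From Gamma-convergence to Hausdorff convergence\<close>

lemma connected_avoiding_sphere_subset_ball:
  fixes S :: "'a::metric_space set"
  assumes "connected S" "y \<in> S" "dist x y < R" "S \<inter> sphere x R = {}"
  shows "S \<subseteq> ball x R"
proof (rule ccontr)
  assume "\<not> S \<subseteq> ball x R"
  moreover have split: "S \<subseteq> ball x R \<union> (- cball x R)"
    using assms(4) by (force simp: disjoint_iff)
  ultimately have "(- cball x R) \<inter> S \<noteq> {}" by blast
  moreover have "ball x R \<inter> S \<noteq> {}" using assms(2,3) by auto
  moreover have "ball x R \<inter> (- cball x R) \<inter> S = {}" by auto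
  ultimately show False
    using connectedD[OF assms(1), of "ball x R" "- cball x R"] split by (simp add: open_Compl)
qed

text \<open>
  Connectedness prevents mass from escaping. The sphere bounding the ball, lifted to height \<open>\<alpha>\<close>,
  is a compact set outside \<open>end u\<close>, so the cuts of \<open>us n\<close> are eventually disjoint from the sphere,
  while each has a point near \<open>x\<^sub>0\<close>.
\<close>

lemma eventually_cut_in_ball:
  fixes us :: "nat \<Rightarrow> 'a::heine_borel \<Rightarrow> real"
  assumes us: "\<And>n. us n \<in> F_USCGCON" and u: "fuzzy_set u"
    and conv: "Gamma_converges us u"
    and \<alpha>: "0 < \<alpha>" "\<alpha> < u x\<^sub>0" and R: "0 < R" "cut u \<alpha> \<subseteq> ball x\<^sub>0 R"
  shows "\<forall>\<^sub>F n in sequentially. cut (us n) \<alpha> \<subseteq> ball x\<^sub>0 R"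
proof -
  have u1: "u x\<^sub>0 \<le> 1" "0 \<le> u x\<^sub>0" using u by (auto simp: fuzzy_set_def)
  have limsup: "kuratowski_limsup (\<lambda>n. endograph (us n)) = endograph u"
    and liminf: "kuratowski_liminf (\<lambda>n. endograph (us n)) = endograph u"
    using conv by (metis Gamma_converges_def kuratowski_converges_def)+
  have "compact (sphere x\<^sub>0 R \<times> {\<alpha>})"
  proof (intro compact_Times)
    have "closed (sphere x\<^sub>0 R)" unfolding sphere_def
      by (intro closed_Collect_eq continuous_intros)
    moreover have "bounded (sphere x\<^sub>0 R)"
      by (rule bounded_subset[OF bounded_cball]) (rule sphere_cball)
    ultimately show "compact (sphere x\<^sub>0 R)" by (simp add: compact_eq_bounded_closed)
  qed simp
  moreover have "(sphere x\<^sub>0 R \<times> {\<alpha>}) \<inter> endograph u = {}"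
    using R(2) by (fastforce simp: endograph_def cut_def)
  ultimately have "\<forall>\<^sub>F n in sequentially. endograph (us n) \<inter> (sphere x\<^sub>0 R \<times> {\<alpha>}) = {}"
    using limsup by (intro compact_avoids_kuratowski_limsup) auto
  moreover have "\<forall>\<^sub>F n in sequentially.
      \<exists>c\<in>endograph (us n). dist (x\<^sub>0, u x\<^sub>0) c < min R (u x\<^sub>0 - \<alpha>)"
    using liminf R(1) \<alpha>(2) u1
    by (intro kuratowski_liminf_near) (auto simp: endograph_def)
  ultimately show ?thesis
  proof eventually_elim
    case (elim n)
    then obtain y s where ys: "(y, s) \<in> endograph (us n)"
      "dist (x\<^sub>0, u x\<^sub>0) (y, s) < min R (u x\<^sub>0 - \<alpha>)" by auto
    have "dist x\<^sub>0 y < R" "dist (u x\<^sub>0) s < u x\<^sub>0 - \<alpha>"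
      using ys(2) dist_fst_le[of "(x\<^sub>0, u x\<^sub>0)" "(y, s)"] dist_snd_le[of "(x\<^sub>0, u x\<^sub>0)" "(y, s)"]
      by auto
    moreover from this have "y \<in> cut (us n) \<alpha>"
      using ys(1) by (auto simp: cut_def endograph_def dist_real_def)
    moreover have "connected (cut (us n) \<alpha>)"
      using us[of n] \<alpha> u1 by (auto simp: F_USCGCON_def)
    moreover have "cut (us n) \<alpha> \<inter> sphere x\<^sub>0 R = {}"
    proof -
      have "(z, \<alpha>) \<in> endograph (us n)" if "z \<in> cut (us n) \<alpha>" for z
        using that \<alpha> u1 by (simp add: cut_def endograph_def)
      then show ?thesis using elim(1) by blast
    qed
    ultimately show ?case
      by (intro connected_avoiding_sphere_subset_ball)
  qed
qed

lemma Gamma_converges_imp_eventually_limit_near: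
  fixes us :: "nat \<Rightarrow> 'a::heine_borel \<Rightarrow> real"
  assumes us: "\<And>n. fuzzy_set (us n)" and u: "u \<in> F_USCG"
    and conv: "Gamma_converges us u" and e: "0 < e"
  shows "\<forall>\<^sub>F n in sequentially. \<forall>b\<in>endograph u. \<exists>a\<in>endograph (us n). dist a b < e"
proof -
  \<comment> \<open>Boundedness of cuts is only given for levels up to 1.\<close>
  define d where "d = min e 1"
  have d: "0 < d" "d \<le> 1" "d \<le> e" using e by (auto simp: d_def)
  have "endograph u = kuratowski_liminf (\<lambda>n. endograph (us n))"
    using conv by (simp add: Gamma_converges_def kuratowski_converges_def)
  then have "\<forall>\<^sub>F n in sequentially.
      \<forall>b\<in>endograph u \<inter> (UNIV \<times> {d..1}). \<exists>a\<in>endograph (us n). dist a b < e"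
    using compact_high_part_of_endograph[OF u d(1,2)] e
    by (intro compact_near_kuratowski_liminf) auto
  then show ?thesis
  proof (rule eventually_mono)
    fix n
    assume high: "\<forall>b\<in>endograph u \<inter> (UNIV \<times> {d..1}). \<exists>a\<in>endograph (us n). dist a b < e"
    show "\<forall>b\<in>endograph u. \<exists>a\<in>endograph (us n). dist a b < e"
    proof
      fix b assume b: "b \<in> endograph u"
      obtain x t where xt: "b = (x, t)" by fastforce
      have t: "0 \<le> t" "t \<le> 1" using b xt by (auto simp: endograph_def)
      show "\<exists>a\<in>endograph (us n). dist a b < e"
      proof (cases "d \<le> t")
        case True
        then show ?thesis using high b xt t by auto
      next
        case False
        then have "dist (x, 0) b < e"
          using t d(3) by (simp add: xt dist_Pair_Pair)
        then show ?thesis using base_in_endograph[OF us] by blast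
      qed
    qed
  qed
qed

lemma Gamma_converges_imp_eventually_near_limit:
  fixes us :: "nat \<Rightarrow> 'a::heine_borel \<Rightarrow> real"
  assumes us: "\<And>n. us n \<in> F_USCGCON" and u: "u \<in> F_USCG" "u \<noteq> empty_fuzzy_set"
    and conv: "Gamma_converges us u" and e: "0 < e"
  shows "\<forall>\<^sub>F n in sequentially. \<forall>a\<in>endograph (us n). \<exists>b\<in>endograph u. dist a b < e"
proof -
  have fuzzy: "fuzzy_set u" using u(1) by (simp add: F_USCG_def)
  have ne: "endograph u \<noteq> {}" using base_in_endograph[OF fuzzy] by blast
  obtain x\<^sub>0 where "u x\<^sub>0 \<noteq> 0" using u(2) by (auto simp: empty_fuzzy_set_def)
  then have x\<^sub>0: "0 < u x\<^sub>0" "u x\<^sub>0 \<le> 1"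
    using fuzzy by (auto simp: fuzzy_set_def less_le)
  \<comment> \<open>Low enough that \<open>x\<^sub>0\<close> lies strictly above the level, and that everything below is close to
    the base.\<close>
  define \<alpha> where "\<alpha> = min e (u x\<^sub>0) / 2"
  have \<alpha>: "0 < \<alpha>" "\<alpha> < u x\<^sub>0" "\<alpha> < e" using e x\<^sub>0 by (auto simp: \<alpha>_def min_def)
  have "bounded (cut u \<alpha>)" using u(1) \<alpha> x\<^sub>0 by (auto simp: F_USCG_def)
  then obtain R where R: "0 < R" "cut u \<alpha> \<subseteq> ball x\<^sub>0 R"
    using bounded_subset_ballD by blast
  \<comment> \<open>The points where the desired estimate fails, over the ball that traps the cuts.\<close>
  define K where "K = (cball x\<^sub>0 R \<times> {0..1}) \<inter> {p. e \<le> infdist p (endograph u)}"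
  have "compact K"
    unfolding K_def
    by (intro compact_Int_closed compact_Times closed_Collect_le continuous_intros) auto
  moreover have "K \<inter> kuratowski_limsup (\<lambda>n. endograph (us n)) = {}"
    using conv e by (auto simp: K_def Gamma_converges_def kuratowski_converges_def)
  ultimately have "\<forall>\<^sub>F n in sequentially. endograph (us n) \<inter> K = {}"
    by (rule compact_avoids_kuratowski_limsup)
  moreover have "\<forall>\<^sub>F n in sequentially. cut (us n) \<alpha> \<subseteq> ball x\<^sub>0 R"
    using us fuzzy conv \<alpha>(1,2) R by (rule eventually_cut_in_ball)
  ultimately show ?thesis
  proof eventually_elim
    case (elim n)
    show ?case
    proof
      fix a assume a: "a \<in> endograph (us n)"
      obtain x t where xt: "a = (x, t)" by fastforce
      have t: "0 \<le> t" "t \<le> 1" "t \<le> us n x" using a xt by (auto simp: endograph_def)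
      show "\<exists>b\<in>endograph u. dist a b < e"
      proof (cases "\<alpha> \<le> t")
        case True
        then have "x \<in> cut (us n) \<alpha>" using t(3) by (simp add: cut_def)
        then have "x \<in> ball x\<^sub>0 R" using elim(2) by blast
        then have "infdist a (endograph u) < e"
          using elim(1) a xt t by (simp add: K_def disjoint_iff not_le)
        then have "Inf (dist a ` endograph u) < e"
          using ne by (simp add: infdist_notempty)
        then show ?thesis using cInf_lessD[of "dist a ` endograph u"] ne by auto
      next
        case False
        then have "dist a (x, 0) < e"
          using t(1) \<alpha>(3) by (simp add: xt dist_Pair_Pair)
        then show ?thesis using base_in_endograph[OF fuzzy] by blast
      qed
    qed
  qed
qed

theorem theorem9p2:
  fixes us :: "nat \<Rightarrow> real ^ 'm \<Rightarrow> real" and u :: "real ^ 'm \<Rightarrow> real"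
  assumes "\<And>n. us n \<in> F_USCGCON"
    and "u \<in> F_USCG"
    and "u \<noteq> empty_fuzzy_set"
  shows "Gamma_converges us u \<longleftrightarrow> (\<lambda>n. H_end (us n) u) \<longlonglongrightarrow> 0"
proof
  have us: "fuzzy_set (us n)" for n
    using assms(1)[of n] by (simp add: F_USCGCON_def F_USCG_def)
  have u: "fuzzy_set u" "upper_semicontinuous u"
    using assms(2) by (simp_all add: F_USCG_def)
  show "(\<lambda>n. H_end (us n) u) \<longlonglongrightarrow> 0" if "Gamma_converges us u"
    unfolding H_end_def tendsto_hausdorff_metric_zero_iff
    using Gamma_converges_imp_eventually_near_limit[OF assms that]
      Gamma_converges_imp_eventually_limit_near[OF us assms(2) that]
    by (auto intro: eventually_conj)
  show "Gamma_converges us u" if "(\<lambda>n. H_end (us n) u) \<longlonglongrightarrow> 0"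
    unfolding Gamma_converges_def
  proof (rule hausdorff_imp_kuratowski_converges)
    show "(\<lambda>n. hausdorff_metric (endograph (us n)) (endograph u)) \<longlonglongrightarrow> 0"
      using that by (simp add: H_end_def)
    show "endograph (us n) \<noteq> {}" for n using base_in_endograph[OF us] by blast
    show "endograph u \<noteq> {}" using base_in_endograph[OF u(1)] by blast
    show "closed (endograph u)" using u(2) by (rule closed_endograph)
  qed
qed

end
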